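(* Let $\sigma:\Sigma\to\Sigma$ be a transitive subshift of finite type. Suppose $\varphi\in C^0(\Sigma,\mathbb Q)$ is a locally constant function and $A\in C^0(\Sigma)$ is a Walters function. Let $r$ be a rational number with $r\in\mathrm{int}(\varphi_*(\mathcal M_\sigma))$. Then $$\beta_{A,\varphi}(r)=\sup\left\{\int A\,d\mu:\ \mu\in\varphi_*^{-1}(r),\ \mu\text{ a periodic probability measure}\right\}.$$
   Context: $\Sigma$ is a one-sided subshift of finite type over a finite alphabet, with points $\mathbf x=(x_0,x_1,\dots)$ and shift map $\sigma$; it carries the metric $d(\mathbf x,\mathbf y)=\lambda^k$, $k=\min\{j:x_j\ne y_j\}$ (and $d(\mathbf x,\mathbf x)=0$), for a fixed $\lambda\in(0,1)$. $\mathcal M_\sigma$ is the set of $\sigma$-invariant Borel probability measures. For $\varphi\in C^0(\Sigma)$ and $\mu\in\mathcal M_\sigma$, $\varphi_*(\mu)=\int\varphi\,d\mu$, and $\varphi_*^{-1}(r)=\{\mu\in\mathcal M_\sigma:\varphi_*(\mu)=r\}$; $\mathrm{int}$ is the interior in $\mathbb R$. $C^0(\Sigma,\mathbb Q)$ denotes the continuous real functions on $\Sigma$ with values in $\mathbb Q$. For $r\in\varphi_*(\mathcal M_\sigma)$, $\beta_{A,\varphi}(r)=\sup\{\int A\,d\mu:\mu\in\varphi_*^{-1}(r)\}$. A continuous function $g$ on $\Sigma$ is locally constant if there is an integer $j\ge0$ such that $g(\mathbf x)=g(\mathbf y)$ whenever $x_0=y_0,\dots,x_j=y_j$. Put $S_kf=\sum_{j=0}^{k-1}f\circ\sigma^j$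 and $d_k(\mathbf x,\mathbf y)=\max_{0\le j<k}d(\sigma^j\mathbf x,\sigma^j\mathbf y)$. A function $f\in C^0(\Sigma)$ is a Walters function (Walters potential) if there is an increasing function $H:\mathbb R^+\to\mathbb R^+\cup\{+\infty\}$, null and continuous at zero, such that for all $s\in\mathbb R^+$, $k>0$, $\mathbf x,\mathbf y\in\Sigma$: $d_k(\mathbf x,\mathbf y)\le s$ implies $|S_kf(\mathbf x)-S_kf(\mathbf y)|\le H(s)$. A periodic probability measure is a measure of the form $\frac1M\sum_{j=0}^{M-1}\delta_{\sigma^j(\mathbf x)}$ with $\mathbf x$ a periodic point of period $M$. *)

theory Defs
  imports "HOL-Probability.Probability"
begin

definition shift_map :: "(nat \<Rightarrow> 'a) \<Rightarrow> nat \<Rightarrow> 'a" where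
  "shift_map x = (\<lambda>n. x (Suc n))"

text \<open>The elements of \<open>F\<close> are the forbidden words. Subshifts given by a transition matrix are the
  case where all of them have length two.\<close>

definition subshift_of_finite_type :: "(nat \<Rightarrow> 'a) set \<Rightarrow> bool" where
  "subshift_of_finite_type X \<longleftrightarrow>
     (\<exists>F :: 'a list set. finite F \<and> X = {x. \<forall>n. \<forall>w\<in>F. map x [n..<n + length w] \<noteq> w})"

definition shift_dist :: "real \<Rightarrow> (nat \<Rightarrow> 'a) \<Rightarrow> (nat \<Rightarrow> 'a) \<Rightarrow> real" where
  "shift_dist l x y = (if x = y then 0 else l ^ (LEAST j. x j \<noteq> y j))"

lemma shift_dist_Metric_space:
  fixes X :: "(nat \<Rightarrow> 'a) set"
  assumes "0 < l" "l < 1"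
  shows "Metric_space X (shift_dist l)"
proof
  fix x y z :: "nat \<Rightarrow> 'a"
  show "0 \<le> shift_dist l x y"
    using assms by (simp add: shift_dist_def)
  show "shift_dist l x y = shift_dist l y x"
    by (simp add: shift_dist_def eq_commute)
  show "shift_dist l x y = 0 \<longleftrightarrow> x = y"
    using assms by (simp add: shift_dist_def)
  show "shift_dist l x z \<le> shift_dist l x y + shift_dist l y z"
  proof (cases "x = y \<or> y = z \<or> x = z")
    case True
    then show ?thesis using assms by (auto simp: shift_dist_def)
  next
    case False
    define a where "a = (LEAST j. x j \<noteq> y j)"
    define b where "b = (LEAST j. y j \<noteq> z j)"
    define c where "c = (LEAST j. x j \<noteq> z j)"
    have "x c \<noteq> z c"
      unfolding c_def using False by (intro LeastI_ex[where P = "\<lambda>j. x j \<noteq> z j"]) (simp add: fun_eq_iff)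
    then have "x c \<noteq> y c \<or> y c \<noteq> z c"
      by auto
    then have "a \<le> c \<or> b \<le> c"
      unfolding a_def b_def
      by (elim disj_forward) (rule Least_le, assumption)+
    then have "l ^ c \<le> l ^ a \<or> l ^ c \<le> l ^ b"
      using assms power_decreasing[of a c l] power_decreasing[of b c l] by argo
    moreover have "0 < l ^ a" "0 < l ^ b"
      using assms by simp_all
    ultimately have "l ^ c \<le> l ^ a + l ^ b"
      by linarith
    then show ?thesis
      using False by (simp add: shift_dist_def a_def b_def c_def)
  qed
qed

definition shift_topology :: "real \<Rightarrow> (nat \<Rightarrow> 'a) set \<Rightarrow> (nat \<Rightarrow> 'a) topology" where
  "shift_topology l X = Metric_space.mtopology X (shift_dist l)"

definition transitive_shift :: "real \<Rightarrow> (nat \<Rightarrow> 'a) set \<Rightarrow> bool" where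
  "transitive_shift l X \<longleftrightarrow>
     (\<forall>U V. openin (shift_topology l X) U \<and> U \<noteq> {} \<and> openin (shift_topology l X) V \<and> V \<noteq> {} \<longrightarrow>
        (\<exists>n. (shift_map ^^ n) ` U \<inter> V \<noteq> {}))"

text \<open>Potentials are total functions of which only the values on \<open>X\<close> matter.\<close>

definition C0 :: "real \<Rightarrow> (nat \<Rightarrow> 'a) set \<Rightarrow> ((nat \<Rightarrow> 'a) \<Rightarrow> real) set" where
  "C0 l X = {f. continuous_map (shift_topology l X) euclideanreal f}"

definition C0_rat :: "real \<Rightarrow> (nat \<Rightarrow> 'a) set \<Rightarrow> ((nat \<Rightarrow> 'a) \<Rightarrow> real) set" where
  "C0_rat l X = {f \<in> C0 l X. f ` X \<subseteq> \<rat>}"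

definition locally_constant :: "(nat \<Rightarrow> 'a) set \<Rightarrow> ((nat \<Rightarrow> 'a) \<Rightarrow> real) \<Rightarrow> bool" where
  "locally_constant X g \<longleftrightarrow>
     (\<exists>j::nat. \<forall>x\<in>X. \<forall>y\<in>X. (\<forall>i\<le>j. x i = y i) \<longrightarrow> g x = g y)"

definition birkhoff_sum :: "nat \<Rightarrow> ((nat \<Rightarrow> 'a) \<Rightarrow> real) \<Rightarrow> (nat \<Rightarrow> 'a) \<Rightarrow> real" where
  "birkhoff_sum k f x = (\<Sum>j<k. f ((shift_map ^^ j) x))"

definition bowen_dist :: "real \<Rightarrow> nat \<Rightarrow> (nat \<Rightarrow> 'a) \<Rightarrow> (nat \<Rightarrow> 'a) \<Rightarrow> real" where
  "bowen_dist l k x y = Max ((\<lambda>j. shift_dist l ((shift_map ^^ j) x) ((shift_map ^^ j) y)) ` {..<k})"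

definition walters :: "real \<Rightarrow> (nat \<Rightarrow> 'a) set \<Rightarrow> ((nat \<Rightarrow> 'a) \<Rightarrow> real) \<Rightarrow> bool" where
  "walters l X f \<longleftrightarrow> f \<in> C0 l X \<and>
     (\<exists>H :: real \<Rightarrow> ennreal.
        mono_on {0..} H \<and> H 0 = 0 \<and> continuous (at 0 within {0..}) H \<and>
        (\<forall>s\<ge>0. \<forall>k>0. \<forall>x\<in>X. \<forall>y\<in>X.
           bowen_dist l k x y \<le> s \<longrightarrow>
           ennreal \<bar>birkhoff_sum k f x - birkhoff_sum k f y\<bar> \<le> H s))"

definition shift_borel :: "real \<Rightarrow> (nat \<Rightarrow> 'a) set \<Rightarrow> (nat \<Rightarrow> 'a) measure" where
  "shift_borel l X = sigma X {U. openin (shift_topology l X) U}"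

definition invariant_measures :: "real \<Rightarrow> (nat \<Rightarrow> 'a) set \<Rightarrow> (nat \<Rightarrow> 'a) measure set" where
  "invariant_measures l X =
     {\<mu>. sets \<mu> = sets (shift_borel l X) \<and> prob_space \<mu> \<and> distr \<mu> \<mu> shift_map = \<mu>}"

definition rotation_fiber ::
  "real \<Rightarrow> (nat \<Rightarrow> 'a) set \<Rightarrow> ((nat \<Rightarrow> 'a) \<Rightarrow> real) \<Rightarrow> real \<Rightarrow> (nat \<Rightarrow> 'a) measure set" where
  "rotation_fiber l X \<phi> r = {\<mu> \<in> invariant_measures l X. (\<integral>x. \<phi> x \<partial>\<mu>) = r}"

definition periodic_measure :: "real \<Rightarrow> (nat \<Rightarrow> 'a) set \<Rightarrow> (nat \<Rightarrow> 'a) measure \<Rightarrow> bool" where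
  "periodic_measure l X \<mu> \<longleftrightarrow>
     sets \<mu> = sets (shift_borel l X) \<and>
     (\<exists>x\<in>X. \<exists>M>0. (shift_map ^^ M) x = x \<and>
        (\<forall>B\<in>sets \<mu>. emeasure \<mu> B =
           (\<Sum>j<M. emeasure (return (shift_borel l X) ((shift_map ^^ j) x)) B) / of_nat M))"

text \<open>Suprema are taken in the extended reals, so that the supremum of an empty set is
  \<open>-\<infinity>\<close> rather than an unspecified real number.\<close>

definition beta ::
  "real \<Rightarrow> (nat \<Rightarrow> 'a) set \<Rightarrow> ((nat \<Rightarrow> 'a) \<Rightarrow> real) \<Rightarrow> ((nat \<Rightarrow> 'a) \<Rightarrow> real) \<Rightarrow> real \<Rightarrow> ereal" where
  "beta l X A \<phi> r = (SUP \<mu>\<in>rotation_fiber l X \<phi> r. ereal (\<integral>x. A x \<partial>\<mu>))"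

end

theory Submission
  imports Defs
begin

text \<open>Periodic measures of the fibre lie in the fibre, so only one inequality is at stake: if
  \<open>\<integral>A d\<nu> \<le> B\<close> for all periodic measures \<open>\<nu>\<close> with \<open>\<integral>\<phi> d\<nu> = r\<close>, then \<open>\<integral>A d\<mu> \<le> B\<close> for every
  invariant measure \<open>\<mu>\<close> with \<open>\<integral>\<phi> d\<mu> = r\<close>. The function \<open>\<phi>\<close> takes finitely many rational values and
  \<open>r\<close> is rational, so \<open>f = Q (\<phi> - r)\<close> has integer values for a suitable \<open>Q > 0\<close>. Put \<open>g = A - B\<close>.
  In terms of Birkhoff sums over a period, the assumption says that \<open>g\<close> has nonpositive sum on each
  periodic orbit on which \<open>f\<close> has sum zero.

  The proof is a Lagrange multiplier argument. A number \<open>t\<close> is produced such that \<open>g + t f\<close> has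
  nonpositive sum on all periodic orbits (\<open>separating_slope\<close>). By transitivity, each orbit segment
  can be closed up to a periodic orbit at the cost of a bounded error in the Birkhoff sums, so the
  Birkhoff sums of \<open>g + t f\<close> are bounded above on the whole subshift. Integrating them against \<open>\<mu>\<close>
  and dividing by the length gives \<open>\<integral>(g + t f) d\<mu> \<le> 0\<close>
  (\<open>periodic_nonpos_imp_integral_nonpos\<close>). If \<open>\<integral>\<phi> d\<mu> = r\<close>, then \<open>\<integral>f d\<mu> = 0\<close>, and this reads
  \<open>\<integral>A d\<mu> \<le> B\<close>.

  The multiplier exists for the following reason. Each orbit with negative \<open>f\<close>-sum bounds \<open>t\<close> from
  below, each orbit with positive \<open>f\<close>-sum bounds it from above, and both kinds of orbit occur because
  \<open>r\<close> is an interior point. A lower bound never exceeds an upper bound (\<open>opposite_periodic_orbits\<close>):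
  one follows the two orbits for long times in the proportion that balances their \<open>f\<close>-sums. The two
  connecting pieces spoil the balance by some integer \<open>D\<close>; since all sums are integers, passing the
  connections several times and adding turns around one of the orbits restores it exactly. The
  resulting periodic orbit has \<open>f\<close>-sum zero, hence nonpositive \<open>g\<close>-sum, and the influence of the
  connections vanishes as the number of turns grows.

  The Walters condition enters through a window length \<open>p\<close>: orbit segments of length \<open>n\<close> whose first
  \<open>n + p\<close> symbols agree have Birkhoff sums of \<open>A\<close> that differ by at most \<open>1\<close>, whatever \<open>n\<close>. So the
  errors made in gluing do not grow with the number of turns.\<close>

section \<open>Cylinders and the shift metric\<close>

lemma shift_map_funpow: "(shift_map ^^ j) x = (\<lambda>n. x (n + j))"
  by (induction j) (auto simp: shift_map_def)

lemma shift_iterate_closed: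
  assumes "\<And>x. x \<in> X \<Longrightarrow> shift_map x \<in> X" "x \<in> X"
  shows "(shift_map ^^ j) x \<in> X"
  by (induction j) (simp_all add: assms)

lemma shift_dist_le_power_iff:
  assumes "0 < l" "l < 1"
  shows "shift_dist l x y \<le> l ^ n \<longleftrightarrow> (\<forall>i<n. x i = y i)"
proof (cases "x = y")
  case True
  then show ?thesis using assms by (simp add: shift_dist_def)
next
  case False
  define m where "m = (LEAST j. x j \<noteq> y j)"
  have m: "x m \<noteq> y m"
    unfolding m_def using False by (intro LeastI_ex[where P = "\<lambda>j. x j \<noteq> y j"]) (simp add: fun_eq_iff)
  have "shift_dist l x y \<le> l ^ n \<longleftrightarrow> n \<le> m"
    using False assms by (simp add: shift_dist_def m_def power_decreasing_iff)
  also have "\<dots> \<longleftrightarrow> (\<forall>i<n. x i = y i)"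
    using m not_less_Least[where P = "\<lambda>j. x j \<noteq> y j"] unfolding m_def
    by (metis (mono_tags, lifting) leD leI less_le_trans)
  finally show ?thesis .
qed

text \<open>In this form the scale \<open>l\<close> of the metric disappears and openness is a statement about symbols.\<close>

lemma openin_shift_topology_iff:
  assumes "0 < l" "l < 1"
  shows "openin (shift_topology l X) U \<longleftrightarrow>
    U \<subseteq> X \<and> (\<forall>x\<in>U. \<exists>n. \<forall>y\<in>X. (\<forall>i<n. x i = y i) \<longrightarrow> y \<in> U)"
proof -
  interpret Metric_space X "shift_dist l"
    using assms by (rule shift_dist_Metric_space)
  have ball: "(\<exists>r>0. mball x r \<subseteq> U) \<longleftrightarrow> (\<exists>n. \<forall>y\<in>X. (\<forall>i<n. x i = y i) \<longrightarrow> y \<in> U)"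
    if "x \<in> X" for x
  proof
    assume "\<exists>r>0. mball x r \<subseteq> U"
    then obtain r where r: "0 < r" "mball x r \<subseteq> U" by blast
    obtain n where "l ^ n < r"
      using real_arch_pow_inv[OF r(1) assms(2)] by blast
    then have "shift_dist l x y < r" if "\<forall>i<n. x i = y i" for y
      using that shift_dist_le_power_iff[OF assms] by (meson le_less_trans)
    then show "\<exists>n. \<forall>y\<in>X. (\<forall>i<n. x i = y i) \<longrightarrow> y \<in> U"
      using r that by (intro exI[of _ n]) (auto simp: subset_iff)
  next
    assume "\<exists>n. \<forall>y\<in>X. (\<forall>i<n. x i = y i) \<longrightarrow> y \<in> U"
    then obtain n where n: "\<And>y. y \<in> X \<Longrightarrow> (\<forall>i<n. x i = y i) \<Longrightarrow> y \<in> U" by blast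
    have "mball x (l ^ n) \<subseteq> U"
    proof
      fix y assume "y \<in> mball x (l ^ n)"
      then have "y \<in> X" "shift_dist l x y \<le> l ^ n" by auto
      then show "y \<in> U" using n shift_dist_le_power_iff[OF assms] by blast
    qed
    then show "\<exists>r>0. mball x r \<subseteq> U" using assms by (intro exI[of _ "l ^ n"]) auto
  qed
  show ?thesis
    unfolding shift_topology_def openin_mtopology using ball by blast
qed

lemma openin_cylinder:
  assumes "0 < l" "l < 1"
  shows "openin (shift_topology l X) {x \<in> X. \<forall>i<n. x i = u i}"
  unfolding openin_shift_topology_iff[OF assms]
proof (intro conjI ballI)
  fix x assume "x \<in> {x \<in> X. \<forall>i<n. x i = u i}"
  then show "\<exists>k. \<forall>y\<in>X. (\<forall>i<k. x i = y i) \<longrightarrow> y \<in> {x \<in> X. \<forall>i<n. x i = u i}"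
    by (intro exI[of _ n]) simp
qed auto

lemma topspace_shift_topology:
  assumes "0 < l" "l < 1"
  shows "topspace (shift_topology l X) = X"
  unfolding shift_topology_def
  using Metric_space.topspace_mtopology[OF shift_dist_Metric_space[OF assms]] .

text \<open>Compactness of the full shift is only ever used in this combinatorial form: what depends on a
  prefix of fixed length, exactly or up to a bounded error, can be bounded by looking at finitely many
  points.\<close>

lemma finite_prefix_representatives:
  fixes X :: "(nat \<Rightarrow> 'a::finite) set"
  shows "\<exists>R. finite R \<and> R \<subseteq> X \<and> (\<forall>x\<in>X. \<exists>y\<in>R. \<forall>i<p. x i = y i)"
proof -
  define pre :: "(nat \<Rightarrow> 'a) \<Rightarrow> 'a list" where "pre x = map x [0..<p]" for x
  have "finite {xs :: 'a list. set xs \<subseteq> UNIV \<and> length xs = p}"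
    by (rule finite_lists_length_eq) simp
  then have "finite (pre ` X)"
    by (rule rev_finite_subset) (auto simp: pre_def)
  moreover have "\<exists>y\<in>inv_into X pre ` pre ` X. \<forall>i<p. x i = y i" if "x \<in> X" for x
  proof (intro bexI allI impI)
    have "pre (inv_into X pre (pre x)) = pre x"
      using that by (simp add: f_inv_into_f)
    then show "x i = inv_into X pre (pre x) i" if "i < p" for i
      using that by (simp add: pre_def)
  qed (use that in auto)
  ultimately show ?thesis
    by (intro exI[of _ "inv_into X pre ` pre ` X"]) (auto intro: inv_into_into)
qed

section \<open>Birkhoff sums\<close>

lemma birkhoff_sum_eq: "birkhoff_sum k h x = (\<Sum>j<k. h (\<lambda>i. x (i + j)))"
  by (simp add: birkhoff_sum_def shift_map_funpow)

lemma birkhoff_sum_add: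
  "birkhoff_sum (n + m) h x = birkhoff_sum n h x + birkhoff_sum m h ((shift_map ^^ n) x)"
  by (induction m) (simp_all add: birkhoff_sum_eq shift_map_funpow ac_simps)

lemma birkhoff_sum_mult_period:
  assumes "(shift_map ^^ M) x = x"
  shows "birkhoff_sum (a * M) h x = real a * birkhoff_sum M h x"
proof (induction a)
  case (Suc a)
  have "birkhoff_sum (Suc a * M) h x = birkhoff_sum M h x + birkhoff_sum (a * M) h x"
    using birkhoff_sum_add[of M "a * M" h x] assms by simp
  then show ?case using Suc by (simp add: distrib_right)
qed (simp add: birkhoff_sum_def)

text \<open>The bound \<open>C\<close> has to be independent of \<open>n\<close>. It is \<open>0\<close> for functions of the first \<open>p\<close> symbols,
  and a Walters function has some finite bound once \<open>p\<close> is large.\<close>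

definition bounded_distortion ::
  "(nat \<Rightarrow> 'a) set \<Rightarrow> nat \<Rightarrow> real \<Rightarrow> ((nat \<Rightarrow> 'a) \<Rightarrow> real) \<Rightarrow> bool" where
  "bounded_distortion X p C h \<longleftrightarrow> (\<forall>n. \<forall>x\<in>X. \<forall>y\<in>X.
     (\<forall>i<n + p. x i = y i) \<longrightarrow> \<bar>birkhoff_sum n h x - birkhoff_sum n h y\<bar> \<le> C)"

lemma birkhoff_sum_linear:
  "birkhoff_sum n (\<lambda>x. g x + t * f x) x = birkhoff_sum n g x + t * birkhoff_sum n f x"
  by (simp add: birkhoff_sum_def sum.distrib sum_distrib_left)

lemma bounded_distortion_add_mult:
  assumes "bounded_distortion X p C g" "bounded_distortion X p 0 f"
  shows "bounded_distortion X p C (\<lambda>x. g x + t * f x)"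
  unfolding bounded_distortion_def
proof (intro allI ballI impI)
  fix n x y assume xy: "x \<in> X" "y \<in> X" "\<forall>i<n + p. x i = y i"
  have "\<bar>birkhoff_sum n f x - birkhoff_sum n f y\<bar> \<le> 0"
    using assms(2) xy unfolding bounded_distortion_def by blast
  then have "birkhoff_sum n f x = birkhoff_sum n f y" by simp
  moreover have "\<bar>birkhoff_sum n g x - birkhoff_sum n g y\<bar> \<le> C"
    using assms(1) xy unfolding bounded_distortion_def by blast
  ultimately show "\<bar>birkhoff_sum n (\<lambda>x. g x + t * f x) x
      - birkhoff_sum n (\<lambda>x. g x + t * f x) y\<bar> \<le> C"
    by (simp add: birkhoff_sum_linear)
qed

lemma bounded_distortion_bounded:
  fixes X :: "(nat \<Rightarrow> 'a::finite) set"
  assumes "bounded_distortion X p C h"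
  shows "\<exists>b\<ge>0. \<forall>x\<in>X. \<bar>h x\<bar> \<le> b"
proof -
  obtain R where R: "finite R" "R \<subseteq> X" "\<And>x. x \<in> X \<Longrightarrow> \<exists>y\<in>R. \<forall>i<Suc p. x i = y i"
    using finite_prefix_representatives[of X "Suc p"] by blast
  show ?thesis
  proof (intro exI[of _ "(\<Sum>y\<in>R. \<bar>h y\<bar>) + \<bar>C\<bar>"] conjI ballI)
    show "0 \<le> (\<Sum>y\<in>R. \<bar>h y\<bar>) + \<bar>C\<bar>" by (simp add: sum_nonneg)
    fix x assume x: "x \<in> X"
    then obtain y where y: "y \<in> R" "\<forall>i<Suc p. x i = y i" using R by blast
    then have "\<bar>birkhoff_sum 1 h x - birkhoff_sum 1 h y\<bar> \<le> C"
      using assms x R(2) unfolding bounded_distortion_def by (metis plus_1_eq_Suc subsetD)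
    then have "\<bar>h x - h y\<bar> \<le> C" by (simp add: birkhoff_sum_def)
    moreover have "\<bar>h y\<bar> \<le> (\<Sum>y\<in>R. \<bar>h y\<bar>)"
      using R(1) y(1) by (intro member_le_sum) auto
    ultimately show "\<bar>h x\<bar> \<le> (\<Sum>y\<in>R. \<bar>h y\<bar>) + \<bar>C\<bar>" by linarith
  qed
qed

section \<open>Gluing orbit segments\<close>

text \<open>A subshift of finite type seen through a window of length \<open>p\<close>, which may be longer than the
  forbidden words: membership in \<open>X\<close> is decided by the windows of length \<open>p\<close>, and any two of them are
  joined by some orbit. Both properties survive enlarging \<open>p\<close>, so that one window can serve the
  subshift and both potentials.\<close>

locale transitive_window_shift =
  fixes X :: "(nat \<Rightarrow> 'a::finite) set" and p :: nat
  assumes shift_closed: "x \<in> X \<Longrightarrow> shift_map x \<in> X"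
    and windows_in_X: "(\<And>n. \<exists>x\<in>X. \<forall>i<p. y (n + i) = x i) \<Longrightarrow> y \<in> X"
    and connected: "u \<in> X \<Longrightarrow> v \<in> X \<Longrightarrow>
      \<exists>n. \<exists>x\<in>X. (\<forall>i<p. x i = u i) \<and> (\<forall>i<p. x (n + i) = v i)"
begin

text \<open>The \<open>n\<close> steps from \<open>x\<close> lead from the window of \<open>u\<close> to the window of \<open>v\<close>. Only the first \<open>p\<close>
  symbols of \<open>u\<close> and \<open>v\<close> matter; points are used to name windows.\<close>

definition segment :: "nat \<Rightarrow> (nat \<Rightarrow> 'a) \<Rightarrow> (nat \<Rightarrow> 'a) \<Rightarrow> (nat \<Rightarrow> 'a) \<Rightarrow> bool" where
  "segment n u v x \<longleftrightarrow> x \<in> X \<and> (\<forall>i<p. x i = u i) \<and> (\<forall>i<p. x (n + i) = v i)"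

definition periodic :: "nat \<Rightarrow> (nat \<Rightarrow> 'a) \<Rightarrow> bool" where
  "periodic M x \<longleftrightarrow> x \<in> X \<and> 0 < M \<and> (shift_map ^^ M) x = x"

lemma iterate_closed: "x \<in> X \<Longrightarrow> (shift_map ^^ j) x \<in> X"
  by (rule shift_iterate_closed[OF shift_closed])

text \<open>The glued point follows \<open>x\<close> on the first \<open>n + p\<close> symbols, because the end window of \<open>x\<close> is the
  initial window of \<open>y\<close>, and it is exactly \<open>y\<close> after \<open>n\<close> steps. Hence only the first part
  contributes an error, and every window of the glued point occurs in \<open>x\<close> or in \<open>y\<close>.\<close>

lemma glue_segments:
  assumes x: "segment n u v x" and y: "segment m v w y"
  obtains z where "segment (n + m) u w z"
    "\<And>C h. bounded_distortion X p C h \<Longrightarrow>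
      \<bar>birkhoff_sum (n + m) h z - (birkhoff_sum n h x + birkhoff_sum m h y)\<bar> \<le> C"
proof
  define z where "z = (\<lambda>i. if i < n then x i else y (i - n))"
  have zx: "z i = x i" if "i < n + p" for i
  proof (cases "i < n")
    case False
    then have "i - n < p" using that by linarith
    then have "y (i - n) = v (i - n)" "x (n + (i - n)) = v (i - n)"
      using x y unfolding segment_def by blast+
    then show ?thesis using False by (simp add: z_def)
  qed (simp add: z_def)
  have zy: "(shift_map ^^ n) z = y"
    by (simp add: shift_map_funpow z_def)
  have zX: "z \<in> X"
  proof (rule windows_in_X)
    fix k
    show "\<exists>x'\<in>X. \<forall>i<p. z (k + i) = x' i"
    proof (cases "k < n")
      case True
      then show ?thesis using x
        by (intro bexI[of _ "(shift_map ^^ k) x"])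
          (auto simp: iterate_closed segment_def, simp add: shift_map_funpow zx add.commute)
    next
      case False
      then show ?thesis using y
        by (intro bexI[of _ "(shift_map ^^ (k - n)) y"])
          (auto simp: iterate_closed segment_def,
            simp add: shift_map_funpow z_def algebra_simps)
    qed
  qed
  have "z (n + m + i) = y (m + i)" for i
    by (simp add: z_def add.assoc)
  then show "segment (n + m) u w z"
    using x y zX zx by (auto simp: segment_def)
  show "\<bar>birkhoff_sum (n + m) h z - (birkhoff_sum n h x + birkhoff_sum m h y)\<bar> \<le> C"
    if "bounded_distortion X p C h" for C h
  proof -
    have "\<bar>birkhoff_sum n h z - birkhoff_sum n h x\<bar> \<le> C"
      using that zX x zx unfolding bounded_distortion_def segment_def by blast
    then show ?thesis by (simp add: birkhoff_sum_add zy)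
  qed
qed

text \<open>The periodic continuation of the first \<open>n\<close> symbols agrees with \<open>x\<close> for \<open>p\<close> symbols more, also
  when \<open>p\<close> exceeds \<open>n\<close>; each window therefore already occurs in \<open>x\<close>, and a single distortion bound
  covers the whole period.\<close>

lemma close_segment:
  assumes x: "segment n u u x" and n: "0 < n"
  obtains y where "periodic n y"
    "\<And>C h. bounded_distortion X p C h \<Longrightarrow> \<bar>birkhoff_sum n h y - birkhoff_sum n h x\<bar> \<le> C"
proof
  define y where "y = (\<lambda>i. x (i mod n))"
  have yx: "i < n + p \<Longrightarrow> y i = x i" for i
  proof (induction i rule: less_induct)
    case (less i)
    show ?case
    proof (cases "i < n")
      case False
      then have "y i = y (i - n)" by (simp add: y_def le_mod_geq)
      also have "\<dots> = x (i - n)" using less False n by simp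
      also have "\<dots> = x (n + (i - n))"
      proof -
        have "i - n < p" using False less.prems by linarith
        then show ?thesis using x unfolding segment_def by metis
      qed
      finally show ?thesis using False by simp
    qed (simp add: y_def)
  qed
  have "y \<in> X"
  proof (rule windows_in_X)
    fix k
    have "y (k + i) = x (k mod n + i)" if "i < p" for i
    proof -
      have "y (k + i) = y (k mod n + i)" by (simp add: y_def mod_add_left_eq)
      then show ?thesis using yx[of "k mod n + i"] that n
        by (simp add: add_less_mono)
    qed
    then show "\<exists>x'\<in>X. \<forall>i<p. y (k + i) = x' i"
      using x by (intro bexI[of _ "(shift_map ^^ (k mod n)) x"])
        (auto simp: iterate_closed segment_def, simp add: shift_map_funpow add.commute)
  qed
  then show "periodic n y"
    using n by (simp add: periodic_def shift_map_funpow y_def)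
  show "\<bar>birkhoff_sum n h y - birkhoff_sum n h x\<bar> \<le> C" if "bounded_distortion X p C h" for C h
    using that \<open>y \<in> X\<close> x yx unfolding bounded_distortion_def segment_def by blast
qed

text \<open>Going around a periodic orbit \<open>a\<close> times is one segment and needs no gluing, so the error of a
  construction does not depend on the number of turns.\<close>

lemma segment_periodic:
  assumes "periodic M y"
  shows "segment (a * M) y y y"
proof -
  have "(shift_map ^^ (a * M)) y = y"
  proof (induction a)
    case (Suc a)
    have "(shift_map ^^ (Suc a * M)) y = (shift_map ^^ M) ((shift_map ^^ (a * M)) y)"
      by (simp add: funpow_add)
    then show ?case using Suc assms by (simp add: periodic_def)
  qed simp
  then have "y (i + a * M) = y i" for i
    unfolding shift_map_funpow by (rule fun_cong)
  then have "y (a * M + i) = y i" for i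
    by (simp add: add.commute)
  then show ?thesis using assms by (simp add: segment_def periodic_def)
qed

lemma repeat_segment:
  assumes x: "segment n u u x" and f: "bounded_distortion X p 0 f"
  shows "\<exists>z. segment (k * n) u u z \<and> birkhoff_sum (k * n) f z = real k * birkhoff_sum n f x"
proof (induction k)
  case 0
  show ?case using x by (intro exI[of _ x]) (auto simp: segment_def birkhoff_sum_def)
next
  case (Suc k)
  then obtain z where z: "segment (k * n) u u z"
    "birkhoff_sum (k * n) f z = real k * birkhoff_sum n f x" by blast
  obtain w where w: "segment (n + k * n) u u w" "\<And>C h. bounded_distortion X p C h \<Longrightarrow>
    \<bar>birkhoff_sum (n + k * n) h w - (birkhoff_sum n h x + birkhoff_sum (k * n) h z)\<bar> \<le> C"
    using glue_segments[OF x z(1)] by blast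
  have "birkhoff_sum (n + k * n) f w = real (Suc k) * birkhoff_sum n f x"
    using w(2)[OF f] by (simp add: z(2) distrib_right)
  then show ?case using w(1) by (intro exI[of _ w]) simp
qed

section \<open>The constrained inequality on periodic orbits\<close>

text \<open>The \<open>f\<close>-sums \<open>- P\<close> and \<open>Q\<close> over the periods of \<open>y\<close> and \<open>z\<close> are integers, and so is the
  \<open>f\<close>-sum \<open>D\<close> of a round trip along the two connecting segments. A loop that makes the round trip
  \<open>P\<close> times, turns \<open>Q K + D\<close> times around \<open>y\<close> and \<open>P K\<close> times around \<open>z\<close> has \<open>f\<close>-sum
  \<open>P D - P (Q K + D) + Q P K = 0\<close>. Its \<open>g\<close>-sum is \<open>K\<close> times \<open>slope\<close> up to a constant, and must not
  be positive for any large \<open>K\<close>.\<close>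

lemma opposite_periodic_orbits:
  assumes f: "bounded_distortion X p 0 f" "\<And>x. x \<in> X \<Longrightarrow> f x \<in> \<int>"
    and g: "bounded_distortion X p C g"
    and zero: "\<And>M y. periodic M y \<Longrightarrow> birkhoff_sum M f y = 0 \<Longrightarrow> birkhoff_sum M g y \<le> 0"
    and y: "periodic M y" "birkhoff_sum M f y < 0"
    and z: "periodic N z" "0 < birkhoff_sum N f z"
  shows "birkhoff_sum N f z * birkhoff_sum M g y \<le> birkhoff_sum M f y * birkhoff_sum N g z"
proof -
  have int: "birkhoff_sum n f x \<in> \<int>" if "x \<in> X" for n x
    unfolding birkhoff_sum_def using that by (intro Ints_sum f(2) iterate_closed)
  have X: "y \<in> X" "z \<in> X" using y z by (auto simp: periodic_def)
  obtain i where "birkhoff_sum M f y = of_int i" using int[OF X(1), of M] by (auto elim: Ints_cases)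
  then obtain P where P: "birkhoff_sum M f y = - real P" "0 < P"
    using y(2) by (intro that[of "nat (- i)"]) auto
  obtain i where "birkhoff_sum N f z = of_int i" using int[OF X(2), of N] by (auto elim: Ints_cases)
  then obtain Q where Q: "birkhoff_sum N f z = real Q" "0 < Q"
    using z(2) by (intro that[of "nat i"]) auto
  obtain m x where x: "segment m y z x"
    using connected[OF X] by (auto simp: segment_def)
  obtain n w where w: "segment n z y w"
    using connected[OF X(2,1)] by (auto simp: segment_def)
  have fadd: "\<exists>c. segment (a + b) t v c \<and>
      birkhoff_sum (a + b) f c = birkhoff_sum a f d + birkhoff_sum b f e \<and>
      birkhoff_sum (a + b) g c \<ge> birkhoff_sum a g d + birkhoff_sum b g e - C"
    if de: "segment a t u d" "segment b u v e" for a b t u v d e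
  proof -
    obtain c where c: "segment (a + b) t v c" "\<And>C h. bounded_distortion X p C h \<Longrightarrow>
      \<bar>birkhoff_sum (a + b) h c - (birkhoff_sum a h d + birkhoff_sum b h e)\<bar> \<le> C"
      using glue_segments[OF de] by blast
    show ?thesis using c(1) c(2)[OF f(1)] c(2)[OF g] by (intro exI[of _ c]) auto
  qed
  obtain D where D: "birkhoff_sum n f w + birkhoff_sum m f x = of_int D"
    using int[of x m] int[of w n] x w by (metis Ints_add Ints_cases segment_def)
  obtain s where s: "segment (n + m) z z s"
    "birkhoff_sum (n + m) f s = of_int D"
    using fadd[OF w x] D by metis
  obtain s' where s': "segment ((P - 1) * (n + m)) z z s'"
    "birkhoff_sum ((P - 1) * (n + m)) f s' = real (P - 1) * birkhoff_sum (n + m) f s"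
    using repeat_segment[OF s(1) f(1)] by blast
  (* All the extra round trips are stored in a fixed return segment w' from z to y. *)
  obtain n' w' where w': "segment n' z y w'"
    "birkhoff_sum n' f w' = real (P - 1) * birkhoff_sum (n + m) f s + birkhoff_sum n f w"
    using fadd[OF s'(1) w] s'(2) by metis
  have D': "birkhoff_sum m f x + birkhoff_sum n' f w' = real P * of_int D"
    using P(2) D by (simp add: w'(2)[unfolded s(2)] of_nat_diff algebra_simps)
  define const where "const = of_int D * birkhoff_sum M g y + birkhoff_sum m g x
    + birkhoff_sum n' g w' - 4 * C"
  define slope where
    "slope = real Q * birkhoff_sum M g y + real P * birkhoff_sum N g z"
  (* K > |D| makes the number Q K + D of turns around y positive, also for negative D. *)
  have bound: "real K * slope + const \<le> 0" if K: "K > nat \<bar>D\<bar>" for K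
  proof -
    define a where "a = nat (int Q * int K + D)"
    define b where "b = P * K"
    have "int K \<le> int Q * int K" using Q(2) mult_right_mono[of 1 "int Q" "int K"] by simp
    then have "int Q * int K + D > 0" using K by linarith
    then have a: "0 < a" "real a = real Q * real K + of_int D"
      by (simp_all add: a_def)
    have ya: "segment (a * M) y y y" and zb: "segment (b * N) z z z"
      using y z by (auto intro: segment_periodic)
    obtain c1 where c1: "segment (n' + a * M) z y c1"
      "birkhoff_sum (n' + a * M) f c1 = birkhoff_sum n' f w' + birkhoff_sum (a * M) f y"
      "birkhoff_sum (n' + a * M) g c1 \<ge> birkhoff_sum n' g w' + birkhoff_sum (a * M) g y - C"
      using fadd[OF w'(1) ya] by blast
    obtain c2 where c2: "segment (b * N + (n' + a * M)) z y c2"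
      "birkhoff_sum (b * N + (n' + a * M)) f c2 =
        birkhoff_sum (b * N) f z + birkhoff_sum (n' + a * M) f c1"
      "birkhoff_sum (b * N + (n' + a * M)) g c2 \<ge>
        birkhoff_sum (b * N) g z + birkhoff_sum (n' + a * M) g c1 - C"
      using fadd[OF zb c1(1)] by blast
    define L where "L = m + (b * N + (n' + a * M))"
    obtain c3 where c3: "segment L y y c3"
      "birkhoff_sum L f c3 = birkhoff_sum m f x + birkhoff_sum (b * N + (n' + a * M)) f c2"
      "birkhoff_sum L g c3 \<ge> birkhoff_sum m g x + birkhoff_sum (b * N + (n' + a * M)) g c2 - C"
      using fadd[OF x c2(1)] unfolding L_def by blast
    have "0 < L" using a y(1) by (simp add: L_def periodic_def)
    then obtain c where c: "periodic L c" "\<And>C h. bounded_distortion X p C h \<Longrightarrow>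
        \<bar>birkhoff_sum L h c - birkhoff_sum L h c3\<bar> \<le> C"
      using close_segment[OF c3(1)] by blast
    have My: "birkhoff_sum (a * M) h y = real a * birkhoff_sum M h y" for h
      using y(1) by (intro birkhoff_sum_mult_period) (simp add: periodic_def)
    have Nz: "birkhoff_sum (b * N) h z = real b * birkhoff_sum N h z" for h
      using z(1) by (intro birkhoff_sum_mult_period) (simp add: periodic_def)
    have "birkhoff_sum L f c = birkhoff_sum L f c3"
      using c(2)[OF f(1)] by simp
    also have "\<dots> = (birkhoff_sum m f x + birkhoff_sum n' f w')
        + real b * real Q - real a * real P"
      by (simp add: c3 c2 c1 My Nz P Q)
    also have "\<dots> = 0"
      by (simp add: D' a b_def algebra_simps)
    finally have "birkhoff_sum L g c \<le> 0"
      using zero c(1) by blast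
    moreover have "birkhoff_sum L g c \<ge> birkhoff_sum L g c3 - C"
      using c(2)[OF g] by linarith
    moreover have "birkhoff_sum L g c3 \<ge> birkhoff_sum m g x + real b * birkhoff_sum N g z
        + birkhoff_sum n' g w' + real a * birkhoff_sum M g y - 3 * C"
      using c3(3) c2(3) c1(3) unfolding My Nz by linarith
    ultimately have "birkhoff_sum m g x + real b * birkhoff_sum N g z
        + birkhoff_sum n' g w' + real a * birkhoff_sum M g y - 4 * C \<le> 0"
      by linarith
    then show ?thesis
      by (simp add: const_def slope_def a b_def algebra_simps)
  qed
  have "slope \<le> 0"
  proof (rule ccontr)
    assume "\<not> slope \<le> 0"
    then obtain k where k: "\<bar>const\<bar> < real k * slope"
      using reals_Archimedean3[of slope] by force
    define K where "K = max k (Suc (nat \<bar>D\<bar>))"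
    have "real k * slope \<le> real K * slope"
      using \<open>\<not> slope \<le> 0\<close> by (intro mult_right_mono) (auto simp: K_def)
    moreover have "nat \<bar>D\<bar> < K" by (simp add: K_def)
    ultimately show False using bound[of K] k by linarith
  qed
  then show ?thesis by (simp add: slope_def P Q)
qed

text \<open>An orbit with negative \<open>f\<close>-sum \<open>F\<close> and \<open>g\<close>-sum \<open>G\<close> demands \<open>t \<ge> G / (- F)\<close>, one with positive
  \<open>f\<close>-sum demands \<open>t \<le> - G / F\<close>. By the previous lemma these demands are compatible in pairs, and
  the supremum of the lower bounds meets all of them. It is a real number only because orbits of both
  signs exist.\<close>

lemma separating_slope:
  assumes f: "bounded_distortion X p 0 f" "\<And>x. x \<in> X \<Longrightarrow> f x \<in> \<int>"
    and g: "bounded_distortion X p C g"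
    and zero: "\<And>M y. periodic M y \<Longrightarrow> birkhoff_sum M f y = 0 \<Longrightarrow> birkhoff_sum M g y \<le> 0"
    and neg: "\<exists>M y. periodic M y \<and> birkhoff_sum M f y < 0"
    and pos: "\<exists>M y. periodic M y \<and> 0 < birkhoff_sum M f y"
  obtains t where "\<And>M y. periodic M y \<Longrightarrow> birkhoff_sum M g y + t * birkhoff_sum M f y \<le> 0"
proof
  define S where "S = {birkhoff_sum M g y / - birkhoff_sum M f y |M y.
    periodic M y \<and> birkhoff_sum M f y < 0}"
  have ne: "S \<noteq> {}" using neg by (auto simp: S_def)
  have upper: "s \<le> - birkhoff_sum N g z / birkhoff_sum N f z"
    if "s \<in> S" and z: "periodic N z" "0 < birkhoff_sum N f z" for s N z
  proof -
    obtain M y where y: "s = birkhoff_sum M g y / - birkhoff_sum M f y"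
      "periodic M y" "birkhoff_sum M f y < 0"
      using \<open>s \<in> S\<close> by (auto simp: S_def)
    have "G / - F \<le> - G' / F'" if "F < 0" "0 < F'" "F' * G \<le> F * G'" for F F' G G' :: real
      using that by (simp add: field_simps)
    then show ?thesis
      using opposite_periodic_orbits[OF f g zero y(2,3) z] y(1,3) z(2) by blast
  qed
  have bdd: "bdd_above S" using pos upper by (meson bdd_above.I)
  show "birkhoff_sum M g y + Sup S * birkhoff_sum M f y \<le> 0" if y: "periodic M y" for M y
  proof (cases "birkhoff_sum M f y" "0 :: real" rule: linorder_cases)
    case less
    have "birkhoff_sum M g y / - birkhoff_sum M f y \<le> Sup S"
      using bdd y less by (intro cSup_upper) (auto simp: S_def)
    then show ?thesis using less by (simp add: field_simps)
  next
    case equal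
    then show ?thesis using zero y by simp
  next
    case greater
    have "Sup S \<le> - birkhoff_sum M g y / birkhoff_sum M f y"
      using ne upper y greater by (intro cSup_least) auto
    then show ?thesis using greater by (simp add: field_simps)
  qed
qed

section \<open>Closing orbit segments\<close>

lemma bounded_connections:
  obtains c where "\<And>u v. u \<in> X \<Longrightarrow> v \<in> X \<Longrightarrow> \<exists>n\<le>c. \<exists>x. segment n u v x"
proof -
  obtain R where R: "finite R" "R \<subseteq> X" "\<And>x. x \<in> X \<Longrightarrow> \<exists>y\<in>R. \<forall>i<p. x i = y i"
    using finite_prefix_representatives[of X p] by blast
  have "\<forall>q\<in>R \<times> R. \<exists>n. \<exists>x. segment n (fst q) (snd q) x"
  proof
    fix q assume "q \<in> R \<times> R"
    then have "fst q \<in> X" "snd q \<in> X" using R(2) by auto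
    then show "\<exists>n. \<exists>x. segment n (fst q) (snd q) x"
      using connected unfolding segment_def by blast
  qed
  from bchoice[OF this] obtain k
    where "\<forall>q\<in>R \<times> R. \<exists>x. segment (k q) (fst q) (snd q) x" by blast
  then have k: "\<exists>x. segment (k (u, v)) u v x" if "u \<in> R" "v \<in> R" for u v
    using that by fastforce
  show ?thesis
  proof (rule that)
    fix u v assume "u \<in> X" "v \<in> X"
    then obtain u' v' where uv: "u' \<in> R" "v' \<in> R" "\<forall>i<p. u i = u' i" "\<forall>i<p. v i = v' i"
      using R(3) by metis
    then obtain x where "segment (k (u', v')) u' v' x" using k by blast
    then have "segment (k (u', v')) u v x" using uv by (simp add: segment_def)
    moreover have "k (u', v') \<le> (\<Sum>q\<in>R \<times> R. k q)"
      using R(1) uv by (intro member_le_sum) auto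
    ultimately show "\<exists>n\<le>\<Sum>q\<in>R \<times> R. k q. \<exists>x. segment n u v x" by blast
  qed
qed

text \<open>The segment from \<open>x\<close> is closed by a connection of bounded length, on which the bounded function
  \<open>h\<close> has a bounded sum; gluing and closing cost \<open>C\<close> each.\<close>

lemma bounded_closing:
  assumes h: "bounded_distortion X p C h"
  obtains E where "\<And>n x. x \<in> X \<Longrightarrow> 0 < n \<Longrightarrow>
    \<exists>N y. periodic N y \<and> \<bar>birkhoff_sum N h y - birkhoff_sum n h x\<bar> \<le> E"
proof -
  obtain c where c: "\<And>u v. u \<in> X \<Longrightarrow> v \<in> X \<Longrightarrow> \<exists>n\<le>c. \<exists>x. segment n u v x"
    using bounded_connections by blast
  obtain b where b: "0 \<le> b" "\<And>x. x \<in> X \<Longrightarrow> \<bar>h x\<bar> \<le> b"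
    using bounded_distortion_bounded[OF h] by blast
  show ?thesis
  proof (rule that)
    fix n x assume x: "x \<in> X" and n: "0 < (n :: nat)"
    have "segment n x ((shift_map ^^ n) x) x"
      using x by (simp add: segment_def shift_map_funpow add.commute)
    moreover obtain m w where w: "m \<le> c" "segment m ((shift_map ^^ n) x) x w"
      using c[OF iterate_closed[OF x] x] by blast
    ultimately obtain z where z: "segment (n + m) x x z"
      "\<bar>birkhoff_sum (n + m) h z - (birkhoff_sum n h x + birkhoff_sum m h w)\<bar> \<le> C"
      using glue_segments h by metis
    obtain y where y: "periodic (n + m) y"
      "\<bar>birkhoff_sum (n + m) h y - birkhoff_sum (n + m) h z\<bar> \<le> C"
      using close_segment[OF z(1)] n h by (metis add_gr_0)
    have "\<bar>birkhoff_sum m h w\<bar> \<le> (\<Sum>j<m. b)"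
      unfolding birkhoff_sum_def
      using w(2) by (intro order_trans[OF sum_abs] sum_mono b iterate_closed)
        (simp add: segment_def)
    also have "\<dots> \<le> real c * b" using w(1) b(1) by (simp add: mult_right_mono)
    finally show "\<exists>N y. periodic N y \<and>
        \<bar>birkhoff_sum N h y - birkhoff_sum n h x\<bar> \<le> 2 * C + real c * b"
      using y z(2) by (intro exI[of _ "n + m"] exI[of _ y]) auto
  qed
qed

end

section \<open>Invariant measures\<close>

lemma space_shift_borel: "space (shift_borel l X) = X"
  by (simp add: shift_borel_def space_measure_of_conv)

lemma sets_shift_borel_openin:
  assumes "0 < l" "l < 1" "openin (shift_topology l X) U"
  shows "U \<in> sets (shift_borel l X)"
proof -
  have "{U. openin (shift_topology l X) U} \<subseteq> Pow X"
    using openin_subset topspace_shift_topology[OF assms(1,2)] by fastforce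
  then show ?thesis using assms(3) by (simp add: shift_borel_def)
qed

lemma C0_borel_measurable:
  assumes "0 < l" "l < 1" "f \<in> C0 l X"
  shows "f \<in> borel_measurable (shift_borel l X)"
proof (rule borel_measurableI)
  fix S :: "real set" assume "open S"
  then have "openin (shift_topology l X) {x \<in> topspace (shift_topology l X). f x \<in> S}"
    using assms(3) by (intro openin_continuous_map_preimage) (auto simp: C0_def)
  moreover have "{x \<in> topspace (shift_topology l X). f x \<in> S} = f -` S \<inter> space (shift_borel l X)"
    using topspace_shift_topology[OF assms(1,2)] by (auto simp: space_shift_borel)
  ultimately show "f -` S \<inter> space (shift_borel l X) \<in> sets (shift_borel l X)"
    using sets_shift_borel_openin[OF assms(1,2)] by metis
qed

lemma shift_map_measurable:
  assumes l: "0 < l" "l < 1" and closed: "\<And>x. x \<in> X \<Longrightarrow> shift_map x \<in> X"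
  shows "shift_map \<in> measurable (shift_borel l X) (shift_borel l X)"
proof -
  have "shift_map \<in> measurable (shift_borel l X) (sigma X {U. openin (shift_topology l X) U})"
  proof (rule measurable_measure_of)
    show "{U. openin (shift_topology l X) U} \<subseteq> Pow X"
      using openin_subset topspace_shift_topology[OF l] by fastforce
    show "shift_map \<in> space (shift_borel l X) \<rightarrow> X"
      using closed by (auto simp: space_shift_borel)
    fix U assume "U \<in> {U. openin (shift_topology l X) U}"
    then have U: "openin (shift_topology l X) U" by simp
    have "openin (shift_topology l X) {x \<in> X. shift_map x \<in> U}"
      unfolding openin_shift_topology_iff[OF l]
    proof (intro conjI ballI)
      fix x assume "x \<in> {x \<in> X. shift_map x \<in> U}"
      then obtain n where n: "\<And>y. y \<in> X \<Longrightarrow> (\<forall>i<n. shift_map x i = y i) \<Longrightarrow> y \<in> U"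
        using U unfolding openin_shift_topology_iff[OF l] by blast
      have "y \<in> {x \<in> X. shift_map x \<in> U}" if "y \<in> X" "\<forall>i<Suc n. x i = y i" for y
        using that closed n[of "shift_map y"] by (auto simp: shift_map_def)
      then show "\<exists>n. \<forall>y\<in>X. (\<forall>i<n. x i = y i) \<longrightarrow> y \<in> {x \<in> X. shift_map x \<in> U}"
        by blast
    qed auto
    moreover have "shift_map -` U \<inter> space (shift_borel l X) = {x \<in> X. shift_map x \<in> U}"
      by (auto simp: space_shift_borel)
    ultimately show "shift_map -` U \<inter> space (shift_borel l X) \<in> sets (shift_borel l X)"
      using sets_shift_borel_openin[OF l] by simp
  qed
  then show ?thesis by (simp add: shift_borel_def)
qed

lemma invariant_measures_integrable:
  fixes h :: "(nat \<Rightarrow> 'a) \<Rightarrow> real"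
  assumes \<mu>: "\<mu> \<in> invariant_measures l X"
    and h: "h \<in> borel_measurable (shift_borel l X)" "\<And>x. x \<in> X \<Longrightarrow> \<bar>h x\<bar> \<le> b"
  shows "integrable \<mu> h"
proof -
  have sets: "sets \<mu> = sets (shift_borel l X)" and "prob_space \<mu>"
    using \<mu> by (auto simp: invariant_measures_def)
  interpret prob_space \<mu> by fact
  have "space \<mu> = X" using sets_eq_imp_space_eq[OF sets] by (simp add: space_shift_borel)
  moreover have "h \<in> borel_measurable \<mu>" using h(1) measurable_cong_sets[OF sets refl] by blast
  ultimately show ?thesis using h(2)
    by (intro integrable_const_bound[of _ b]) auto
qed

lemma integral_birkhoff_sum:
  fixes h :: "(nat \<Rightarrow> 'a) \<Rightarrow> real"
  assumes l: "0 < l" "l < 1" and closed: "\<And>x. x \<in> X \<Longrightarrow> shift_map x \<in> X"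
    and \<mu>: "\<mu> \<in> invariant_measures l X"
    and h: "h \<in> borel_measurable (shift_borel l X)" "\<And>x. x \<in> X \<Longrightarrow> \<bar>h x\<bar> \<le> b"
  shows "integrable \<mu> (birkhoff_sum n h)"
    and "(\<integral>x. birkhoff_sum n h x \<partial>\<mu>) = real n * (\<integral>x. h x \<partial>\<mu>)"
proof -
  have sets: "sets \<mu> = sets (shift_borel l X)" and inv: "distr \<mu> \<mu> shift_map = \<mu>"
    using \<mu> by (auto simp: invariant_measures_def)
  have \<sigma>: "shift_map \<in> measurable \<mu> \<mu>"
    using shift_map_measurable[OF l closed] measurable_cong_sets[OF sets sets] by blast
  have meas: "(\<lambda>x. h ((shift_map ^^ j) x)) \<in> borel_measurable (shift_borel l X)" for j
  proof (induction j)
    case (Suc j)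
    then show ?case
      using measurable_compose[OF shift_map_measurable[OF l closed] Suc]
      by (simp add: funpow_swap1)
  qed (use h in simp)
  note orbit = shift_iterate_closed[OF closed]
  have int: "integrable \<mu> (\<lambda>x. h ((shift_map ^^ j) x))" for j
    using invariant_measures_integrable[OF \<mu> meas] h(2) orbit by blast
  have eq: "(\<integral>x. h ((shift_map ^^ j) x) \<partial>\<mu>) = (\<integral>x. h x \<partial>\<mu>)" for j
  proof (induction j)
    case (Suc j)
    have "(\<integral>x. h ((shift_map ^^ j) x) \<partial>distr \<mu> \<mu> shift_map)
        = (\<integral>x. h ((shift_map ^^ j) (shift_map x)) \<partial>\<mu>)"
      using meas[of j] measurable_cong_sets[OF sets refl] by (intro integral_distr[OF \<sigma>]) blast
    then show ?case using Suc by (simp add: inv funpow_swap1)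
  qed simp
  show "integrable \<mu> (birkhoff_sum n h)"
    unfolding birkhoff_sum_def using int by (intro Bochner_Integration.integrable_sum)
  show "(\<integral>x. birkhoff_sum n h x \<partial>\<mu>) = real n * (\<integral>x. h x \<partial>\<mu>)"
    unfolding birkhoff_sum_def using int eq by (subst Bochner_Integration.integral_sum) auto
qed

text \<open>Integrating the \<open>n\<close>-th Birkhoff sum gives \<open>n \<integral>h d\<mu> \<le> E\<close> for all \<open>n\<close>.\<close>

lemma bounded_birkhoff_sums_imp_integral_nonpos:
  fixes h :: "(nat \<Rightarrow> 'a) \<Rightarrow> real"
  assumes l: "0 < l" "l < 1" and closed: "\<And>x. x \<in> X \<Longrightarrow> shift_map x \<in> X"
    and \<mu>: "\<mu> \<in> invariant_measures l X"
    and h: "h \<in> borel_measurable (shift_borel l X)" "\<And>x. x \<in> X \<Longrightarrow> \<bar>h x\<bar> \<le> b"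
    and E: "\<And>n x. x \<in> X \<Longrightarrow> 0 < n \<Longrightarrow> birkhoff_sum n h x \<le> E"
  shows "(\<integral>x. h x \<partial>\<mu>) \<le> 0"
proof -
  have sets: "sets \<mu> = sets (shift_borel l X)" and "prob_space \<mu>"
    using \<mu> by (auto simp: invariant_measures_def)
  interpret prob_space \<mu> by fact
  have X: "space \<mu> = X" using sets_eq_imp_space_eq[OF sets] by (simp add: space_shift_borel)
  have bound: "real n * (\<integral>x. h x \<partial>\<mu>) \<le> E" if "0 < n" for n
  proof -
    have "(\<integral>x. birkhoff_sum n h x \<partial>\<mu>) \<le> E"
      using integral_birkhoff_sum(1)[OF l closed \<mu> h] E that X
      by (intro integral_le_const) auto
    then show ?thesis using integral_birkhoff_sum(2)[OF l closed \<mu> h] by simp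
  qed
  show ?thesis
  proof (rule ccontr)
    assume "\<not> (\<integral>x. h x \<partial>\<mu>) \<le> 0"
    then obtain k where k: "\<bar>E\<bar> < real k * (\<integral>x. h x \<partial>\<mu>)"
      using reals_Archimedean3[of "\<integral>x. h x \<partial>\<mu>"] by force
    then have "0 < k" by (cases k) auto
    then show False using bound[of k] k by linarith
  qed
qed

text \<open>The orbit measure is the image of the uniform distribution on the indices below \<open>M\<close>. Its
  invariance is then the fact that rotating the indices preserves the uniform distribution.\<close>

lemma periodic_orbit_measure:
  fixes X :: "(nat \<Rightarrow> 'a) set"
  assumes l: "0 < l" "l < 1" and closed: "\<And>x. x \<in> X \<Longrightarrow> shift_map x \<in> X"
    and x: "x \<in> X" "0 < M" "(shift_map ^^ M) x = x"
  obtains \<mu> where "\<mu> \<in> invariant_measures l X" "periodic_measure l X \<mu>"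
    "\<And>h :: (nat \<Rightarrow> 'a) \<Rightarrow> real. h \<in> borel_measurable (shift_borel l X) \<Longrightarrow>
      (\<integral>x. h x \<partial>\<mu>) = birkhoff_sum M h x / real M"
proof -
  define S where "S = shift_borel l X"
  define orb where "orb j = (shift_map ^^ j) x" for j
  define P where "P = pmf_of_set {..<M}"
  define \<mu> where "\<mu> = distr (measure_pmf P) S orb"
  define next_index where "next_index j = Suc j mod M" for j
  have ne: "{..<M} \<noteq> {}" using x(2) by auto
  have orbX: "orb j \<in> X" for j
    unfolding orb_def by (rule shift_iterate_closed[OF closed x(1)])
  have orb: "orb \<in> measurable (measure_pmf P) S"
    using orbX by (simp add: S_def space_shift_borel)
  have sets: "sets \<mu> = sets S" by (simp add: \<mu>_def)
  have prob: "prob_space \<mu>"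
    unfolding \<mu>_def by (rule measure_pmf.prob_space_distr[OF orb])
  have \<sigma>: "shift_map \<in> measurable S S"
    unfolding S_def by (rule shift_map_measurable[OF l closed])
  have "shift_map (orb j) = orb (next_index j)" for j
  proof -
    have "shift_map (orb j) = (shift_map ^^ Suc j) x" by (simp add: orb_def)
    also have "\<dots> = (shift_map ^^ (Suc j mod M)) x"
      by (rule funpow_mod_eq[OF x(3), symmetric])
    finally show ?thesis by (simp add: orb_def next_index_def)
  qed
  then have shift_orb: "shift_map \<circ> orb = orb \<circ> next_index" by (simp add: fun_eq_iff)
  have bij: "bij_betw next_index {..<M} {..<M}"
    by (rule bij_betw_byWitness[where f' = "\<lambda>j. if j = 0 then M - 1 else j - 1"])
      (use x(2) in \<open>auto simp: next_index_def mod_Suc\<close>)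
  have "map_pmf next_index P = P"
    unfolding P_def using ne by (intro map_pmf_of_set_bij_betw[OF bij]) auto
  then have rot: "distr (measure_pmf P) (count_space UNIV) next_index = measure_pmf P"
    by (metis map_pmf_rep_eq)
  have "distr \<mu> \<mu> shift_map = distr \<mu> S shift_map"
    by (intro distr_cong) (simp_all add: sets)
  also have "\<dots> = distr (measure_pmf P) S (orb \<circ> next_index)"
    unfolding \<mu>_def by (subst distr_distr[OF \<sigma> orb]) (simp add: shift_orb)
  also have "\<dots> = distr (distr (measure_pmf P) (count_space UNIV) next_index) S orb"
    using orbX by (subst distr_distr) (auto simp: S_def space_shift_borel)
  also have "\<dots> = \<mu>" by (simp add: rot \<mu>_def)
  finally have inv: "\<mu> \<in> invariant_measures l X"
    using prob sets by (simp add: invariant_measures_def S_def)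
  have emeasure: "emeasure \<mu> B = (\<Sum>j<M. emeasure (return S (orb j)) B) / of_nat M"
    if B: "B \<in> sets \<mu>" for B
  proof -
    have BS: "B \<in> sets S" using B sets by simp
    have "emeasure \<mu> B = emeasure (measure_pmf P) (orb -` B)"
      unfolding \<mu>_def using BS by (subst emeasure_distr[OF orb]) simp_all
    also have "\<dots> = of_nat (card ({..<M} \<inter> orb -` B)) / of_nat M"
      unfolding P_def using ne x(2)
      by (subst emeasure_pmf_of_set)
        (auto simp: divide_ennreal ennreal_of_nat_eq_real_of_nat)
    also have "of_nat (card ({..<M} \<inter> orb -` B)) = (\<Sum>j<M. indicator B (orb j) :: ennreal)"
      by (simp add: indicator_def sum.If_cases Int_def vimage_def)
    also have "\<dots> = (\<Sum>j<M. emeasure (return S (orb j)) B)"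
      using BS by simp
    finally show ?thesis .
  qed
  have "periodic_measure l X \<mu>"
    unfolding periodic_measure_def using sets x emeasure
    unfolding S_def orb_def by blast
  moreover have "(\<integral>x. h x \<partial>\<mu>) = birkhoff_sum M h x / real M"
    if "h \<in> borel_measurable (shift_borel l X)" for h :: "(nat \<Rightarrow> 'a) \<Rightarrow> real"
  proof -
    have "(\<integral>x. h x \<partial>\<mu>) = (\<integral>j. h (orb j) \<partial>measure_pmf P)"
      unfolding \<mu>_def using that by (intro integral_distr[OF orb]) (simp add: S_def)
    also have "\<dots> = (\<Sum>j<M. h (orb j)) / real M"
      unfolding P_def using ne by (simp add: integral_pmf_of_set)
    finally show ?thesis by (simp add: birkhoff_sum_def orb_def)
  qed
  ultimately show ?thesis using that inv by blast
qed

lemma (in transitive_window_shift) periodic_nonpos_imp_integral_nonpos: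
  assumes l: "0 < l" "l < 1"
    and h: "bounded_distortion X p C h" "h \<in> borel_measurable (shift_borel l X)"
    and nonpos: "\<And>M y. periodic M y \<Longrightarrow> birkhoff_sum M h y \<le> 0"
    and \<mu>: "\<mu> \<in> invariant_measures l X"
  shows "(\<integral>x. h x \<partial>\<mu>) \<le> 0"
proof -
  obtain b where b: "\<And>x. x \<in> X \<Longrightarrow> \<bar>h x\<bar> \<le> b"
    using bounded_distortion_bounded[OF h(1)] by blast
  obtain E where E: "\<And>n x. x \<in> X \<Longrightarrow> 0 < n \<Longrightarrow>
    \<exists>N y. periodic N y \<and> \<bar>birkhoff_sum N h y - birkhoff_sum n h x\<bar> \<le> E"
    using bounded_closing[OF h(1)] by blast
  have "birkhoff_sum n h x \<le> E" if x: "x \<in> X" "0 < n" for n x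
  proof -
    obtain N y where "periodic N y" "\<bar>birkhoff_sum N h y - birkhoff_sum n h x\<bar> \<le> E"
      using E[OF x] by blast
    then show ?thesis using nonpos[of N y] by linarith
  qed
  then show ?thesis
    using bounded_birkhoff_sums_imp_integral_nonpos[OF l shift_closed \<mu> h(2) b] by blast
qed

section \<open>The hypotheses on the subshift and the potentials\<close>

lemma subshift_of_finite_type_shift_closed:
  assumes "subshift_of_finite_type X" "x \<in> X"
  shows "shift_map x \<in> X"
proof -
  obtain F where X: "X = {x. \<forall>n. \<forall>w\<in>F. map x [n..<n + length w] \<noteq> w}"
    using assms(1) by (auto simp: subshift_of_finite_type_def)
  have "map (shift_map x) [n..<n + k] = map x [Suc n..<Suc n + k]" for n k
    by (rule nth_equalityI) (simp_all add: shift_map_def del: upt_Suc)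
  then show ?thesis using assms(2) unfolding X mem_Collect_eq by metis
qed

lemma subshift_of_finite_type_window:
  assumes "subshift_of_finite_type X"
  obtains q where "\<And>p y. q \<le> p \<Longrightarrow> (\<And>n. \<exists>x\<in>X. \<forall>i<p. y (n + i) = x i) \<Longrightarrow> y \<in> X"
proof -
  obtain F where F: "finite F" and X: "X = {x. \<forall>n. \<forall>w\<in>F. map x [n..<n + length w] \<noteq> w}"
    using assms by (auto simp: subshift_of_finite_type_def)
  show ?thesis
  proof (rule that)
    fix p y assume p: "(\<Sum>w\<in>F. length w) \<le> p"
      and y: "\<And>n. \<exists>x\<in>X. \<forall>i<p. y (n + i) = x i"
    have "map y [n..<n + length w] \<noteq> w" if w: "w \<in> F" for n w
    proof -
      obtain x where x: "x \<in> X" "\<forall>i<p. y (n + i) = x i" using y by blast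
      have "length w \<le> (\<Sum>w\<in>F. length w)" using F w by (intro member_le_sum) auto
      then have "map y [n..<n + length w] = map x [0..<0 + length w]"
        using p x(2) by (intro nth_equalityI) auto
      moreover have "map x [0..<0 + length w] \<noteq> w" using x(1) w unfolding X by blast
      ultimately show ?thesis by simp
    qed
    then show "y \<in> X" unfolding X by blast
  qed
qed

lemma transitive_shift_connected:
  assumes l: "0 < l" "l < 1" and trans: "transitive_shift l X" and uv: "u \<in> X" "v \<in> X"
  shows "\<exists>n. \<exists>x\<in>X. (\<forall>i<p. x i = u i) \<and> (\<forall>i<p. x (n + i) = v i)"
proof -
  define U where "U w = {x \<in> X. \<forall>i<p. x i = w i}" for w
  have "openin (shift_topology l X) (U w)" for w
    unfolding U_def by (rule openin_cylinder[OF l])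
  moreover have "U u \<noteq> {}" "U v \<noteq> {}" using uv by (auto simp: U_def)
  ultimately obtain n where "(shift_map ^^ n) ` U u \<inter> U v \<noteq> {}"
    using trans unfolding transitive_shift_def by blast
  then show ?thesis
    by (intro exI[of _ n]) (auto simp: U_def shift_map_funpow add.commute)
qed

lemma bounded_distortion_locally_constant:
  assumes closed: "\<And>x. x \<in> X \<Longrightarrow> shift_map x \<in> X"
    and f: "\<And>x y. x \<in> X \<Longrightarrow> y \<in> X \<Longrightarrow> \<forall>i<p. x i = y i \<Longrightarrow> f x = f y"
  shows "bounded_distortion X p 0 f"
  unfolding bounded_distortion_def
proof (intro allI ballI impI)
  fix n x y assume xy: "x \<in> X" "y \<in> X" "\<forall>i<n + p. x i = y i"
  note orbit = shift_iterate_closed[OF closed]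
  have "f ((shift_map ^^ j) x) = f ((shift_map ^^ j) y)" if "j < n" for j
    using xy that by (intro f orbit) (auto simp: shift_map_funpow)
  then show "\<bar>birkhoff_sum n f x - birkhoff_sum n f y\<bar> \<le> 0"
    by (simp add: birkhoff_sum_def)
qed

text \<open>Agreement on \<open>n + p\<close> symbols means Bowen distance at most \<open>l ^ p\<close> for \<open>n\<close> steps, and the modulus
  \<open>H\<close> is below \<open>1\<close> near zero.\<close>

lemma walters_bounded_distortion:
  assumes l: "0 < l" "l < 1" and "walters l X A"
  obtains q where "\<And>p. q \<le> p \<Longrightarrow> bounded_distortion X p 1 A"
proof -
  obtain H :: "real \<Rightarrow> ennreal" where H: "H 0 = 0" "continuous (at 0 within {0..}) H"
    "\<forall>s\<ge>0. \<forall>k>0. \<forall>x\<in>X. \<forall>y\<in>X. bowen_dist l k x y \<le> s \<longrightarrow>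
      ennreal \<bar>birkhoff_sum k A x - birkhoff_sum k A y\<bar> \<le> H s"
    using assms(3) unfolding walters_def by (elim conjE exE)
  have "(H \<longlongrightarrow> 0) (at 0 within {0..})"
    using H(1,2) by (simp add: continuous_within)
  then have "\<forall>\<^sub>F s in at 0 within {0..}. H s < 1"
    by (rule order_tendstoD) simp
  then obtain d where d: "0 < d" "\<And>s. 0 < s \<Longrightarrow> s < d \<Longrightarrow> H s < 1"
    unfolding eventually_at by (auto simp: dist_real_def)
  obtain q where q: "l ^ q < d" using real_arch_pow_inv[OF d(1) l(2)] by blast
  show ?thesis
  proof (rule that)
    fix p assume "q \<le> p"
    then have "l ^ p \<le> l ^ q" using l by (intro power_decreasing) auto
    then have "l ^ p < d" using q by linarith
    then have Hp: "H (l ^ p) < 1" using l by (intro d(2)) auto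
    have "\<bar>birkhoff_sum n A x - birkhoff_sum n A y\<bar> \<le> 1"
      if xy: "x \<in> X" "y \<in> X" "\<forall>i<n + p. x i = y i" for n x y
    proof (cases "n = 0")
      case False
      have "shift_dist l ((shift_map ^^ j) x) ((shift_map ^^ j) y) \<le> l ^ p" if "j < n" for j
        using xy(3) that unfolding shift_dist_le_power_iff[OF l] by (simp add: shift_map_funpow)
      then have "bowen_dist l n x y \<le> l ^ p"
        unfolding bowen_dist_def using False by (subst Max_le_iff) auto
      then have "ennreal \<bar>birkhoff_sum n A x - birkhoff_sum n A y\<bar> \<le> H (l ^ p)"
        using False l xy H(3) by simp
      from le_less_trans[OF this Hp]
      have "ennreal \<bar>birkhoff_sum n A x - birkhoff_sum n A y\<bar> < ennreal 1" by simp
      then show ?thesis by (simp add: ennreal_less_iff)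
    qed (simp add: birkhoff_sum_def)
    then show "bounded_distortion X p 1 A" by (simp add: bounded_distortion_def)
  qed
qed

lemma common_denominator:
  fixes V :: "real set"
  assumes "finite V" "V \<subseteq> \<rat>"
  shows "\<exists>Q>0::nat. \<forall>v\<in>V. real Q * v \<in> \<int>"
  using assms
proof (induction V rule: finite_induct)
  case (insert v V)
  then obtain Q where Q: "0 < Q" "\<forall>v\<in>V. real Q * v \<in> \<int>" by auto
  from insert.prems have "v \<in> \<rat>" by simp
  then obtain i n where v: "v = real_of_int i / real n" "n \<noteq> 0"
    by (auto simp: Rats_eq_int_div_nat)
  have "real (n * Q) * w \<in> \<int>" if "w \<in> insert v V" for w
  proof (cases "w = v")
    case True
    then have "real (n * Q) * w = of_int (i * int Q)" using v by simp
    then show ?thesis by (metis Ints_of_int)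
  next
    case False
    then have "real Q * w \<in> \<int>" using that Q(2) by auto
    then have "real n * (real Q * w) \<in> \<int>" by (rule Ints_mult[OF Ints_of_nat])
    then show ?thesis unfolding of_nat_mult mult.assoc .
  qed
  then show ?case using Q(1) v(2) by (intro exI[of _ "n * Q"]) auto
qed (intro exI[of _ 1], simp)

section \<open>Periodic measures with prescribed rotation number\<close>

theorem proposition14:
  fixes X :: "(nat \<Rightarrow> 'a::finite) set"
    and \<phi> A :: "(nat \<Rightarrow> 'a) \<Rightarrow> real"
    and l r :: real
  assumes "0 < l" and "l < 1"
    and "subshift_of_finite_type X"
    and "transitive_shift l X"
    and "\<phi> \<in> C0_rat l X"
    and "locally_constant X \<phi>"
    and "walters l X A"
    and "r \<in> \<rat>"
    and "r \<in> interior ((\<lambda>\<mu>. \<integral>x. \<phi> x \<partial>\<mu>) ` invariant_measures l X)"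
  shows "beta l X A \<phi> r =
    (SUP \<mu>\<in>{\<mu> \<in> rotation_fiber l X \<phi> r. periodic_measure l X \<mu>}. ereal (\<integral>x. A x \<partial>\<mu>))"
proof -
  note l = assms(1,2)
  note closed = subshift_of_finite_type_shift_closed[OF assms(3)]
  obtain q1 where q1: "\<And>p y. q1 \<le> p \<Longrightarrow> (\<And>n. \<exists>x\<in>X. \<forall>i<p. y (n + i) = x i) \<Longrightarrow> y \<in> X"
    using subshift_of_finite_type_window[OF assms(3)] by blast
  obtain q2 where q2: "\<And>p. q2 \<le> p \<Longrightarrow> bounded_distortion X p 1 A"
    using walters_bounded_distortion[OF l assms(7)] by blast
  obtain j where j: "\<And>x y. x \<in> X \<Longrightarrow> y \<in> X \<Longrightarrow> \<forall>i\<le>j. x i = y i \<Longrightarrow> \<phi> x = \<phi> y"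
    using assms(6) unfolding locally_constant_def by blast
  define p where "p = q1 + q2 + Suc j"
  interpret transitive_window_shift X p
  proof
    show "y \<in> X" if "\<And>n. \<exists>x\<in>X. \<forall>i<p. y (n + i) = x i" for y
      by (rule q1[OF _ that]) (simp_all add: p_def)
  qed (use closed transitive_shift_connected[OF l assms(4)] in auto)
  have \<phi>_window: "\<phi> x = \<phi> y" if "x \<in> X" "y \<in> X" "\<forall>i<p. x i = y i" for x y
    using that by (intro j) (auto simp: p_def)
  have meas: "\<phi> \<in> borel_measurable (shift_borel l X)" "A \<in> borel_measurable (shift_borel l X)"
    using assms(5,7) C0_borel_measurable[OF l] by (auto simp: C0_rat_def walters_def)
  have A: "bounded_distortion X p 1 A" by (rule q2) (simp add: p_def)
  obtain R where R: "finite R" "R \<subseteq> X" "\<And>x. x \<in> X \<Longrightarrow> \<exists>y\<in>R. \<forall>i<p. x i = y i"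
    using finite_prefix_representatives[of X p] by blast
  have "\<phi> ` X \<subseteq> \<phi> ` R"
  proof
    fix v assume "v \<in> \<phi> ` X"
    then obtain x where x: "x \<in> X" "v = \<phi> x" by blast
    then obtain y where y: "y \<in> R" "\<forall>i<p. x i = y i" using R(3) by blast
    then have "\<phi> x = \<phi> y" using x(1) R(2) by (intro \<phi>_window) auto
    then show "v \<in> \<phi> ` R" using x(2) y(1) by blast
  qed
  then have "finite ((\<lambda>v. v - r) ` \<phi> ` X)" using R(1) finite_subset by blast
  moreover have "(\<lambda>v. v - r) ` \<phi> ` X \<subseteq> \<rat>"
    using assms(5,8) by (auto simp: C0_rat_def)
  ultimately obtain Q :: nat where Q: "0 < Q" "\<And>x. x \<in> X \<Longrightarrow> real Q * (\<phi> x - r) \<in> \<int>"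
    using common_denominator[of "(\<lambda>v. v - r) ` \<phi> ` X"] by auto
  define f where "f x = real Q * (\<phi> x - r)" for x
  have f: "bounded_distortion X p 0 f" "\<And>x. x \<in> X \<Longrightarrow> f x \<in> \<int>"
    "f \<in> borel_measurable (shift_borel l X)"
  proof -
    have "f x = f y" if "x \<in> X" "y \<in> X" "\<forall>i<p. x i = y i" for x y
      using \<phi>_window[OF that] by (simp add: f_def)
    then show "bounded_distortion X p 0 f"
      using bounded_distortion_locally_constant[of X p f] closed by blast
    show "f x \<in> \<int>" if "x \<in> X" for x unfolding f_def by (rule Q(2)[OF that])
    show "f \<in> borel_measurable (shift_borel l X)"
      unfolding f_def using meas(1) by measurable
  qed
  obtain b where b: "\<And>x. x \<in> X \<Longrightarrow> \<bar>f x\<bar> \<le> b"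
    using bounded_distortion_bounded[OF f(1)] by blast
  obtain b' where b': "\<And>x. x \<in> X \<Longrightarrow> \<bar>A x\<bar> \<le> b'"
    using bounded_distortion_bounded[OF A] by blast
  have int: "integrable \<mu> f" "integrable \<mu> A" "prob_space \<mu>"
    "(\<integral>x. \<phi> x \<partial>\<mu>) = (\<integral>x. f x \<partial>\<mu>) / real Q + r"
    if \<mu>: "\<mu> \<in> invariant_measures l X" for \<mu>
  proof -
    show "integrable \<mu> f" by (rule invariant_measures_integrable[OF \<mu> f(3) b])
    show "integrable \<mu> A" by (rule invariant_measures_integrable[OF \<mu> meas(2) b'])
    show "prob_space \<mu>" using \<mu> by (simp add: invariant_measures_def)
    then interpret prob_space \<mu> .
    have "\<phi> = (\<lambda>x. f x / real Q + r)" using Q(1) by (simp add: f_def fun_eq_iff)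
    then have "(\<integral>x. \<phi> x \<partial>\<mu>) = (\<integral>x. f x / real Q + r \<partial>\<mu>)" by simp
    also have "\<dots> = (\<integral>x. f x \<partial>\<mu>) / real Q + r"
      using \<open>integrable \<mu> f\<close> by (simp add: prob_space)
    finally show "(\<integral>x. \<phi> x \<partial>\<mu>) = (\<integral>x. f x \<partial>\<mu>) / real Q + r" .
  qed
  obtain e where e: "0 < e"
    "ball r e \<subseteq> (\<lambda>\<mu>. \<integral>x. \<phi> x \<partial>\<mu>) ` invariant_measures l X"
    using assms(9) by (auto simp: mem_interior)
  (* Otherwise no invariant measure could have a rotation number above r. *)
  have pos: "\<exists>M y. periodic M y \<and> 0 < birkhoff_sum M f y"
  proof (rule ccontr)
    assume none: "\<not> ?thesis"
    have "r + e / 2 \<in> ball r e" using e(1) by (simp add: dist_real_def)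
    then obtain \<mu> where \<mu>: "\<mu> \<in> invariant_measures l X" "(\<integral>x. \<phi> x \<partial>\<mu>) = r + e / 2"
      using e(2) by fastforce
    have "(\<integral>x. f x \<partial>\<mu>) \<le> 0"
      using none by (intro periodic_nonpos_imp_integral_nonpos[OF l f(1,3) _ \<mu>(1)])
        (meson not_le)
    then have "(\<integral>x. f x \<partial>\<mu>) / real Q \<le> 0" by (simp add: divide_nonpos_nonneg)
    then show False using int(4)[OF \<mu>(1)] \<mu>(2) e(1) by linarith
  qed
  (* The same for - f, in the shape 0 + (- 1) * f that fits the lemma on combinations. *)
  have neg: "\<exists>M y. periodic M y \<and> birkhoff_sum M f y < 0"
  proof (rule ccontr)
    assume none: "\<not> ?thesis"
    have "r - e / 2 \<in> ball r e" using e(1) by (simp add: dist_real_def)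
    then obtain \<mu> where \<mu>: "\<mu> \<in> invariant_measures l X" "(\<integral>x. \<phi> x \<partial>\<mu>) = r - e / 2"
      using e(2) by fastforce
    have "bounded_distortion X p 0 (\<lambda>x. 0 :: real)"
      by (simp add: bounded_distortion_def birkhoff_sum_def)
    then have "(\<integral>x. 0 + (- 1) * f x \<partial>\<mu>) \<le> 0"
    proof (rule periodic_nonpos_imp_integral_nonpos
        [OF l bounded_distortion_add_mult[OF _ f(1)] _ _ \<mu>(1)])
      show "(\<lambda>x. 0 + (- 1) * f x) \<in> borel_measurable (shift_borel l X)"
        using f(3) by measurable
      fix M y assume "periodic M y"
      then have "\<not> birkhoff_sum M f y < 0" using none by blast
      then show "birkhoff_sum M (\<lambda>x. 0 + (- 1) * f x) y \<le> 0"
        by (simp only: birkhoff_sum_linear) (simp add: birkhoff_sum_def)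
    qed
    then have "0 \<le> (\<integral>x. f x \<partial>\<mu>) / real Q" by simp
    then show False using int(4)[OF \<mu>(1)] \<mu>(2) e(1) by linarith
  qed
  let ?fiber = "rotation_fiber l X \<phi> r"
  let ?per = "{\<mu> \<in> ?fiber. periodic_measure l X \<mu>}"
  have key: "(\<integral>x. A x \<partial>\<mu>) \<le> B"
    if B: "\<And>\<nu>. \<nu> \<in> ?per \<Longrightarrow> (\<integral>x. A x \<partial>\<nu>) \<le> B" and \<mu>: "\<mu> \<in> ?fiber" for B \<mu>
  proof -
    define g where "g x = A x - B" for x
    have bs_g: "birkhoff_sum n g x = birkhoff_sum n A x - real n * B" for n x
      by (simp add: birkhoff_sum_def g_def sum_subtractf)
    have g: "bounded_distortion X p 1 g"
      using A by (simp add: bounded_distortion_def bs_g)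
    have zero: "birkhoff_sum M g y \<le> 0" if y: "periodic M y" "birkhoff_sum M f y = 0" for M y
    proof -
      have y': "y \<in> X" "0 < M" "(shift_map ^^ M) y = y" using y(1) by (auto simp: periodic_def)
      obtain \<nu> where \<nu>: "\<nu> \<in> invariant_measures l X" "periodic_measure l X \<nu>"
        "\<And>h :: (nat \<Rightarrow> 'a) \<Rightarrow> real. h \<in> borel_measurable (shift_borel l X) \<Longrightarrow>
          (\<integral>x. h x \<partial>\<nu>) = birkhoff_sum M h y / real M"
        using periodic_orbit_measure[OF l closed y'] by blast
      have "\<nu> \<in> ?per"
        using \<nu>(1,2) int(4)[OF \<nu>(1)] \<nu>(3)[OF f(3)] y(2) by (simp add: rotation_fiber_def)
      then have "birkhoff_sum M A y / real M \<le> B" using B \<nu>(3)[OF meas(2)] by metis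
      then show ?thesis using y'(2) by (simp add: bs_g field_simps)
    qed
    obtain t where t: "\<And>M y. periodic M y \<Longrightarrow> birkhoff_sum M g y + t * birkhoff_sum M f y \<le> 0"
      using separating_slope[OF f(1,2) g zero neg pos] by blast
    define h where "h x = g x + t * f x" for x
    have bs_h: "birkhoff_sum n h x = birkhoff_sum n g x + t * birkhoff_sum n f x" for n x
      unfolding h_def by (rule birkhoff_sum_linear)
    have "bounded_distortion X p 1 h"
      unfolding h_def by (rule bounded_distortion_add_mult[OF g f(1)])
    moreover have "h \<in> borel_measurable (shift_borel l X)"
      unfolding h_def g_def using meas(2) f(3) by simp
    moreover have \<mu>': "\<mu> \<in> invariant_measures l X" "(\<integral>x. \<phi> x \<partial>\<mu>) = r"
      using \<mu> by (auto simp: rotation_fiber_def)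
    ultimately have nonpos: "(\<integral>x. h x \<partial>\<mu>) \<le> 0"
      using t unfolding bs_h[symmetric]
      by (intro periodic_nonpos_imp_integral_nonpos[OF l]) blast+
    interpret prob_space \<mu> using int(3)[OF \<mu>'(1)] .
    have "(\<integral>x. h x \<partial>\<mu>) = (\<integral>x. A x \<partial>\<mu>) - B + t * (\<integral>x. f x \<partial>\<mu>)"
      unfolding h_def g_def using int(1,2)[OF \<mu>'(1)] by (simp add: prob_space)
    moreover have "(\<integral>x. f x \<partial>\<mu>) = 0"
      using int(4)[OF \<mu>'(1)] \<mu>'(2) Q(1) by simp
    ultimately show ?thesis using nonpos by simp
  qed
  show ?thesis
    unfolding beta_def
  proof (rule antisym)
    show "(SUP \<mu>\<in>?per. ereal (\<integral>x. A x \<partial>\<mu>)) \<le> (SUP \<mu>\<in>?fiber. ereal (\<integral>x. A x \<partial>\<mu>))"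
      by (rule SUP_subset_mono) auto
    show "(SUP \<mu>\<in>?fiber. ereal (\<integral>x. A x \<partial>\<mu>)) \<le> (SUP \<mu>\<in>?per. ereal (\<integral>x. A x \<partial>\<mu>))"
    proof (rule ereal_le_real)
      fix B assume "(SUP \<mu>\<in>?per. ereal (\<integral>x. A x \<partial>\<mu>)) \<le> ereal B"
      then have "(\<integral>x. A x \<partial>\<nu>) \<le> B" if "\<nu> \<in> ?per" for \<nu>
        using that by (simp add: SUP_le_iff)
      then show "(SUP \<mu>\<in>?fiber. ereal (\<integral>x. A x \<partial>\<mu>)) \<le> ereal B"
        using key by (intro SUP_least) simp
    qed
  qed
qed

end
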